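(* There exist finite, simple, unweighted geodetic graphs $G$ of diameter two such that for every drawing $\varphi$ of $G$ in $\mathbb{R}^2$ there are two shortest paths $P_1,P_2$ in $G$ whose curves $\varphi(P_1)$ and $\varphi(P_2)$ meet more than once.
   Context: A graph is geodetic if between every pair of vertices there is a unique shortest path (edges unweighted). A drawing $\varphi$ of a graph $G$ in $\mathbb{R}^2$ maps the vertices to pairwise distinct points and each edge to a Jordan arc between the images of its two end-vertices that is disjoint from the image of every other vertex. For a path $P=v_1,\dots,v_n$ in $G$, $\varphi(P)$ denotes the arc obtained by concatenating the curves $\varphi(v_1v_2),\dots,\varphi(v_{n-1}v_n)$. For two curves $\gamma_1,\gamma_2:[0,1]\to\mathbb{R}^2$, a meet is a pair of maximal intervals $I_1,I_2\subseteq[0,1]$ together with a bijection $\iota:I_1\to I_2$ such that $\gamma_1(x)=\gamma_2(\iota(x))$ for all $x\in I_1$; the curves meet $k$ times if they have $k$ pairwise distinct meets. *)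

theory Defs
  imports "HOL-Analysis.Analysis" "HOL-Library.FuncSet"
begin

definition simple_graph :: "'a set \<Rightarrow> 'a set set \<Rightarrow> bool" where
  "simple_graph V E \<longleftrightarrow> (\<forall>e\<in>E. e \<subseteq> V \<and> card e = 2)"

text \<open>Paths are vertex lists, so an undirected path is represented by a list and by its reverse.\<close>

definition graph_path :: "'a set \<Rightarrow> 'a set set \<Rightarrow> 'a \<Rightarrow> 'a \<Rightarrow> 'a list \<Rightarrow> bool" where
  "graph_path V E u v p \<longleftrightarrow>
     p \<noteq> [] \<and> hd p = u \<and> last p = v \<and> set p \<subseteq> V \<and> distinct p \<and>
     successively (\<lambda>x y. {x, y} \<in> E) p"

definition shortest_path :: "'a set \<Rightarrow> 'a set set \<Rightarrow> 'a \<Rightarrow> 'a \<Rightarrow> 'a list \<Rightarrow> bool" where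
  "shortest_path V E u v p \<longleftrightarrow>
     graph_path V E u v p \<and> (\<forall>q. graph_path V E u v q \<longrightarrow> length p \<le> length q)"

definition geodetic :: "'a set \<Rightarrow> 'a set set \<Rightarrow> bool" where
  "geodetic V E \<longleftrightarrow> (\<forall>u\<in>V. \<forall>v\<in>V. \<exists>!p. shortest_path V E u v p)"

text \<open>The number of edges of a path is one less than the length of its vertex list. The two
  definitions below are meaningful for finite, nonempty, connected graphs only.\<close>

definition graph_dist :: "'a set \<Rightarrow> 'a set set \<Rightarrow> 'a \<Rightarrow> 'a \<Rightarrow> nat" where
  "graph_dist V E u v = (LEAST n. \<exists>p. graph_path V E u v p \<and> length p = Suc n)"

definition graph_diameter :: "'a set \<Rightarrow> 'a set set \<Rightarrow> nat" where
  "graph_diameter V E = Max {graph_dist V E u v | u v. u \<in> V \<and> v \<in> V}"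

text \<open>A drawing consists of a map \<open>pt\<close> on vertices and a map \<open>crv\<close> assigning to each
  (undirected) edge an arc, parametrised in either direction.\<close>

definition drawing ::
    "'a set \<Rightarrow> 'a set set \<Rightarrow> ('a \<Rightarrow> real^2) \<Rightarrow> ('a set \<Rightarrow> real \<Rightarrow> real^2) \<Rightarrow> bool" where
  "drawing V E pt crv \<longleftrightarrow>
     inj_on pt V \<and>
     (\<forall>e\<in>E. arc (crv e) \<and> {pathstart (crv e), pathfinish (crv e)} = pt ` e \<and>
            (\<forall>w\<in>V - e. pt w \<notin> path_image (crv e)))"

definition edge_curve ::
    "('a \<Rightarrow> real^2) \<Rightarrow> ('a set \<Rightarrow> real \<Rightarrow> real^2) \<Rightarrow> 'a \<Rightarrow> 'a \<Rightarrow> real \<Rightarrow> real^2" where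
  "edge_curve pt crv u v =
     (if pathstart (crv {u, v}) = pt u then crv {u, v} else reversepath (crv {u, v}))"

text \<open>Deliberately unspecified for paths without edges.\<close>

fun path_curve ::
    "('a \<Rightarrow> real^2) \<Rightarrow> ('a set \<Rightarrow> real \<Rightarrow> real^2) \<Rightarrow> 'a list \<Rightarrow> real \<Rightarrow> real^2" where
  "path_curve pt crv [u, v] = edge_curve pt crv u v"
| "path_curve pt crv (u # v # w # ws) = edge_curve pt crv u v +++ path_curve pt crv (v # w # ws)"

text \<open>Intervals are nonempty and may be single points; a transversal crossing is a pair of
  one-point intervals.\<close>

definition common_part ::
    "(real \<Rightarrow> 'b) \<Rightarrow> (real \<Rightarrow> 'b) \<Rightarrow> real set \<Rightarrow> real set \<Rightarrow> (real \<Rightarrow> real) \<Rightarrow> bool" where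
  "common_part \<gamma>1 \<gamma>2 I1 I2 \<iota> \<longleftrightarrow>
     is_interval I1 \<and> I1 \<noteq> {} \<and> I1 \<subseteq> {0..1} \<and>
     is_interval I2 \<and> I2 \<noteq> {} \<and> I2 \<subseteq> {0..1} \<and>
     bij_betw \<iota> I1 I2 \<and> (\<forall>x\<in>I1. \<gamma>1 x = \<gamma>2 (\<iota> x))"

text \<open>The bijection is taken in \<^const>\<open>extensional\<close>, so that its irrelevant values outside
  of \<open>I1\<close> do not produce several meets out of one.\<close>

definition meets ::
    "(real \<Rightarrow> 'b) \<Rightarrow> (real \<Rightarrow> 'b) \<Rightarrow> (real set \<times> real set \<times> (real \<Rightarrow> real)) set" where
  "meets \<gamma>1 \<gamma>2 =
     {(I1, I2, \<iota>). common_part \<gamma>1 \<gamma>2 I1 I2 \<iota> \<and> \<iota> \<in> extensional I1 \<and>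
        (\<forall>J1 J2 \<kappa>. common_part \<gamma>1 \<gamma>2 J1 J2 \<kappa> \<and> I1 \<subseteq> J1 \<and> I2 \<subseteq> J2 \<longrightarrow> J1 = I1 \<and> J2 = I2)}"

definition meet_times :: "(real \<Rightarrow> 'b) \<Rightarrow> (real \<Rightarrow> 'b) \<Rightarrow> nat \<Rightarrow> bool" where
  "meet_times \<gamma>1 \<gamma>2 k \<longleftrightarrow> (\<exists>M. M \<subseteq> meets \<gamma>1 \<gamma>2 \<and> finite M \<and> card M = k)"

end

theory Submission
  imports Defs
begin

text \<open>
  The Petersen graph is geodetic of diameter two and every path with two edges is a shortest path.
  Suppose that no two shortest paths meet twice. Two edges \<open>ab\<close>, \<open>bc\<close> then share the point of \<open>b\<close>
  only, as any further common point is visited twice by the path \<open>abc\<close>, which gives it two meets with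
  the path \<open>bc\<close>. Two disjoint edges \<open>ab\<close>, \<open>cd\<close> do not intersect: if \<open>bc\<close> is an edge, then \<open>abc\<close> and
  \<open>cd\<close> meet already in \<open>c\<close>, and otherwise, in terms of the common neighbour \<open>x\<close> of \<open>b\<close> and \<open>c\<close>, the
  paths \<open>abx\<close> and \<open>xcd\<close> meet already in \<open>x\<close>. Hence the drawing is plane, but the Petersen graph
  contains a subdivision of $K_{3,3}$.

  For the nonplanarity of $K_{3,3}$, let three arcs join \<open>a\<close> to \<open>b\<close>. Janiszewski's theorem implies
  that one of them enters the inside of the Jordan curve formed by the other two, which it splits into
  the insides of the other two Jordan curves. A point joined to all three arcs, to each one without
  meeting the other two, lies in this inside because of the middle arc, hence in one of its two parts,
  and cannot be joined to the outer arc that does not bound this part.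
\<close>

section \<open>Theta curves and $K_{3,3}$\<close>

lemma outside_Int_outside_subset:
  fixes S T :: "complex set"
  assumes "compact S" "compact T" "connected (S \<inter> T)"
  shows "outside S \<inter> outside T \<subseteq> outside (S \<union> T)"
proof
  fix z assume z: "z \<in> outside S \<inter> outside T"
  have bounded: "bounded S" "bounded T" "bounded (S \<union> T)"
    using assms compact_imp_bounded by auto
  have joined: "connected_component (- U) w z" if "bounded U" "w \<in> outside U" "z \<in> outside U"
    for U and w z :: complex
    using connected_outside[OF \<open>bounded U\<close>] that
    by (intro connected_componentI[of "outside U"]) (auto simp: outside_def)
  obtain w where w: "w \<in> outside (S \<union> T)"
    using outside_bounded_nonempty[OF bounded(3)] by blast
  then have "w \<in> outside S" "w \<in> outside T"
    using outside_mono[of S "S \<union> T"] outside_mono[of T "S \<union> T"] by auto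
  then have "connected_component (- (S \<union> T)) w z"
    using Janiszewski[OF \<open>compact S\<close> compact_imp_closed[OF \<open>compact T\<close>] \<open>connected (S \<inter> T)\<close>]
      joined bounded z by blast
  then show "z \<in> outside (S \<union> T)"
    using outside_same_component w by blast
qed

definition bigon :: "'a::topological_space \<Rightarrow> 'a \<Rightarrow> (real \<Rightarrow> 'a) \<Rightarrow> (real \<Rightarrow> 'a) \<Rightarrow> bool" where
  "bigon a b c d \<longleftrightarrow> arc c \<and> arc d \<and> pathstart c = a \<and> pathfinish c = b \<and>
     pathstart d = a \<and> pathfinish d = b \<and> path_image c \<inter> path_image d = {a, b}"

lemma bigon_sym: "bigon a b c d \<Longrightarrow> bigon a b d c"
  by (auto simp: bigon_def)

abbreviation bigon_image :: "(real \<Rightarrow> 'a::topological_space) \<Rightarrow> (real \<Rightarrow> 'a) \<Rightarrow> 'a set" where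
  "bigon_image c d \<equiv> path_image c \<union> path_image d"

lemma bigon_Jordan:
  fixes c d :: "real \<Rightarrow> complex"
  assumes "bigon a b c d"
  shows "inside (bigon_image c d) \<noteq> {}" "connected (inside (bigon_image c d))"
    "open (outside (bigon_image c d))" "frontier (inside (bigon_image c d)) = bigon_image c d"
proof -
  have "simple_path (c +++ reversepath d)"
    "pathfinish (c +++ reversepath d) = pathstart (c +++ reversepath d)"
    "path_image (c +++ reversepath d) = bigon_image c d"
    using assms
    by (auto simp: bigon_def path_image_join arc_reversepath intro!: simple_path_join_loop)
  from Jordan_inside_outside[OF this(1,2), unfolded this(3)]
  show "inside (bigon_image c d) \<noteq> {}" "connected (inside (bigon_image c d))"
    "open (outside (bigon_image c d))" "frontier (inside (bigon_image c d)) = bigon_image c d"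
    by auto
qed

definition theta ::
    "'a::topological_space \<Rightarrow> 'a \<Rightarrow> (real \<Rightarrow> 'a) \<Rightarrow> (real \<Rightarrow> 'a) \<Rightarrow> (real \<Rightarrow> 'a) \<Rightarrow> bool" where
  "theta a b c1 c2 c3 \<longleftrightarrow> bigon a b c1 c2 \<and> bigon a b c1 c3 \<and> bigon a b c2 c3"

lemma theta_rotate: "theta a b c1 c2 c3 \<Longrightarrow> theta a b c2 c3 c1"
  by (auto simp: theta_def bigon_sym)

lemma theta_swap: "theta a b c1 c2 c3 \<Longrightarrow> theta a b c2 c1 c3"
  by (auto simp: theta_def bigon_sym)

lemma theta_inside_subset:
  fixes c1 c2 c3 :: "real \<Rightarrow> complex"
  assumes "theta a b c1 c2 c3"
  shows "inside (bigon_image c1 c2) \<subseteq>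
    inside (bigon_image c1 c3) \<union> inside (bigon_image c2 c3) \<union> path_image c3"
    (is "inside ?S12 \<subseteq> inside ?S13 \<union> inside ?S23 \<union> _")
proof -
  have "arc c1" "arc c2" "arc c3" and "?S13 \<inter> ?S23 = path_image c3"
    using assms by (auto simp: theta_def bigon_def)
  then have "outside ?S13 \<inter> outside ?S23 \<subseteq> outside (?S13 \<union> ?S23)"
    by (intro outside_Int_outside_subset compact_Un compact_arc_image)
      (simp_all add: connected_arc_image)
  also have "\<dots> \<subseteq> outside ?S12"
    by (intro outside_mono) blast
  finally show ?thesis
    using inside_no_overlap[of ?S12] unfolding outside_inside by blast
qed

lemma theta_arc_inside_of_overlap:
  fixes c1 c2 c3 :: "real \<Rightarrow> complex"
  assumes \<theta>: "theta a b c1 c2 c3"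
    and out: "path_image c3 \<inter> inside (bigon_image c1 c2) = {}"
    and overlap: "inside (bigon_image c1 c2) \<inter> inside (bigon_image c1 c3) \<noteq> {}"
  shows "path_image c2 \<inter> inside (bigon_image c1 c3) \<noteq> {}"
proof -
  let ?S12 = "bigon_image c1 c2" and ?S13 = "bigon_image c1 c3"
  have bigons: "bigon a b c1 c2" "bigon a b c1 c3" "bigon a b c2 c3"
    using \<theta> by (simp_all add: theta_def)
  note connected = bigon_Jordan(2)[OF bigons(1)] and frontier = bigon_Jordan(4)[OF bigons(1)]
    and open_out = bigon_Jordan(3)[OF bigons(2)]
  have "inside ?S12 \<inter> ?S13 = {}"
    using out inside_no_overlap[of ?S12] by blast
  then have "inside ?S12 \<inter> outside ?S13 = {}"
    using inside_outside_intersect_connected[OF connected] overlap by blast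
  then have "closure (inside ?S12) \<inter> outside ?S13 = {}"
    using open_Int_closure_eq_empty[OF open_out] by blast
  moreover have "path_image c2 \<subseteq> closure (inside ?S12)"
    using frontier by (auto simp: closure_Un_frontier)
  moreover obtain q where "q \<in> path_image c2" "q \<notin> {a, b}"
    using bigons nonempty_simple_path_endless[of c2] by (auto simp: bigon_def arc_imp_simple_path)
  moreover have "path_image c2 \<inter> path_image c1 \<subseteq> {a, b}" "path_image c2 \<inter> path_image c3 \<subseteq> {a, b}"
    using bigons by (auto simp: bigon_def)
  ultimately show ?thesis
    unfolding outside_inside by blast
qed

lemma theta_some_arc_inside:
  fixes c1 c2 c3 :: "real \<Rightarrow> complex"
  assumes \<theta>: "theta a b c1 c2 c3"
  shows "path_image c3 \<inter> inside (bigon_image c1 c2) \<noteq> {} \<or>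
    path_image c2 \<inter> inside (bigon_image c1 c3) \<noteq> {} \<or>
    path_image c1 \<inter> inside (bigon_image c2 c3) \<noteq> {}"
proof -
  have "inside (bigon_image c1 c2) \<noteq> {}"
    using bigon_Jordan(1) \<theta> by (auto simp: theta_def)
  then consider "path_image c3 \<inter> inside (bigon_image c1 c2) \<noteq> {}"
    | "inside (bigon_image c1 c2) \<inter> inside (bigon_image c1 c3) \<noteq> {}"
    | "inside (bigon_image c1 c2) \<inter> inside (bigon_image c2 c3) \<noteq> {}"
    using theta_inside_subset[OF \<theta>] by blast
  then show ?thesis
    using theta_arc_inside_of_overlap[OF \<theta>] theta_arc_inside_of_overlap[OF theta_swap[OF \<theta>]]
    by cases (auto simp: Un_commute)
qed

lemma theta_inside_split:
  fixes c1 c2 c3 :: "real \<Rightarrow> complex"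
  assumes "theta a b c1 c2 c3" "path_image c3 \<inter> inside (bigon_image c1 c2) \<noteq> {}"
  shows "inside (bigon_image c1 c2) = inside (bigon_image c1 c3) \<union>
    inside (bigon_image c2 c3) \<union> (path_image c3 - {a, b})"
proof -
  have "a \<noteq> b"
    using assms(1) by (auto simp: theta_def bigon_def dest: arc_distinct_ends)
  then show ?thesis
    using assms split_inside_simple_closed_curve[of c1 a b c2 c3]
    by (auto simp: theta_def bigon_def arc_imp_simple_path)
qed

lemma theta_no_tripod_arc_inside:
  fixes c1 c2 c3 :: "real \<Rightarrow> complex"
  assumes \<theta>: "theta a b c1 c2 c3"
    and inside: "path_image c3 \<inter> inside (bigon_image c1 c2) \<noteq> {}"
    and q1: "q1 \<in> path_image c1" "connected_component (- bigon_image c2 c3) p q1"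
    and q2: "q2 \<in> path_image c2" "connected_component (- bigon_image c1 c3) p q2"
    and q3: "q3 \<in> path_image c3" "connected_component (- bigon_image c1 c2) p q3"
  shows False
proof -
  let ?S12 = "bigon_image c1 c2" and ?S13 = "bigon_image c1 c3"
    and ?S23 = "bigon_image c2 c3"
  note split = theta_inside_split[OF \<theta> inside]
  have "a \<in> path_image c1" "b \<in> path_image c1"
    using \<theta> by (auto simp: theta_def bigon_def)
  moreover have "q3 \<notin> ?S12" "p \<notin> path_image c3"
    using q1(2) q3(2) connected_component_in by fastforce+
  ultimately have "q3 \<in> inside ?S12"
    using q3(1) split by blast
  then have "p \<in> inside ?S12"
    using inside_same_component q3(2) connected_component_sym by blast
  then consider "p \<in> inside ?S13" | "p \<in> inside ?S23"
    using split \<open>p \<notin> path_image c3\<close> by blast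
  then have "q2 \<in> inside ?S12 \<or> q1 \<in> inside ?S12"
    using inside_same_component[OF q2(2)] inside_same_component[OF q1(2)] split by blast
  then show False
    using q1(1) q2(1) inside_no_overlap[of ?S12] by blast
qed

lemma theta_no_tripod:
  fixes c1 c2 c3 :: "real \<Rightarrow> complex"
  assumes \<theta>: "theta a b c1 c2 c3"
    and q1: "q1 \<in> path_image c1" "connected_component (- bigon_image c2 c3) p q1"
    and q2: "q2 \<in> path_image c2" "connected_component (- bigon_image c1 c3) p q2"
    and q3: "q3 \<in> path_image c3" "connected_component (- bigon_image c1 c2) p q3"
  shows False
  using theta_some_arc_inside[OF \<theta>] theta_no_tripod_arc_inside[OF \<theta> _ q1 q2 q3]
    theta_no_tripod_arc_inside[OF theta_rotate[OF \<theta>], of q2 p q3 q1]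
    theta_no_tripod_arc_inside[OF theta_rotate[OF theta_rotate[OF \<theta>]], of q3 p q1 q2]
    q1 q2 q3 by (auto simp: Un_commute)

definition biclique_embedding ::
    "'i set \<Rightarrow> 'i set \<Rightarrow> ('i \<Rightarrow> 'a::topological_space) \<Rightarrow> ('i \<Rightarrow> 'i \<Rightarrow> real \<Rightarrow> 'a) \<Rightarrow> bool" where
  "biclique_embedding X Y pt \<gamma> \<longleftrightarrow>
     (\<forall>x\<in>X. \<forall>y\<in>Y. arc (\<gamma> x y) \<and> pathstart (\<gamma> x y) = pt x \<and> pathfinish (\<gamma> x y) = pt y) \<and>
     (\<forall>x\<in>X. \<forall>y\<in>Y. \<forall>x'\<in>X. \<forall>y'\<in>Y. (x, y) \<noteq> (x', y') \<longrightarrow>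
        path_image (\<gamma> x y) \<inter> path_image (\<gamma> x' y') \<subseteq> pt ` ({x, y} \<inter> {x', y'}))"

lemma biclique_embedding_linear_image:
  fixes h :: "'a::euclidean_space \<Rightarrow> 'b::euclidean_space"
  assumes "biclique_embedding X Y pt \<gamma>" "linear h" "inj h"
  shows "biclique_embedding X Y (h \<circ> pt) (\<lambda>x y. h \<circ> \<gamma> x y)"
  unfolding biclique_embedding_def
proof (intro conjI ballI impI)
  fix x y x' y' assume "x \<in> X" "y \<in> Y" "x' \<in> X" "y' \<in> Y" "(x, y) \<noteq> (x', y')"
  then have "h ` (path_image (\<gamma> x y) \<inter> path_image (\<gamma> x' y')) \<subseteq> h ` pt ` ({x, y} \<inter> {x', y'})"
    using assms(1) by (intro image_mono) (simp add: biclique_embedding_def)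
  then show "path_image (h \<circ> \<gamma> x y) \<inter> path_image (h \<circ> \<gamma> x' y') \<subseteq> (h \<circ> pt) ` ({x, y} \<inter> {x', y'})"
    by (simp add: path_image_compose image_comp image_Int[OF \<open>inj h\<close>])
qed (use assms in \<open>simp_all add: biclique_embedding_def arc_linear_image_eq pathstart_compose
  pathfinish_compose\<close>)

lemma biclique_embedding_arc:
  assumes "biclique_embedding X Y pt \<gamma>" "x \<in> X" "y \<in> Y"
  shows "arc (\<gamma> x y)" "pathstart (\<gamma> x y) = pt x" "pathfinish (\<gamma> x y) = pt y"
    "pt x \<in> path_image (\<gamma> x y)" "pt y \<in> path_image (\<gamma> x y)"
proof -
  show arc: "arc (\<gamma> x y)" "pathstart (\<gamma> x y) = pt x" "pathfinish (\<gamma> x y) = pt y"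
    using assms by (simp_all add: biclique_embedding_def)
  show "pt x \<in> path_image (\<gamma> x y)" "pt y \<in> path_image (\<gamma> x y)"
    using arc(2,3) pathstart_in_path_image pathfinish_in_path_image by metis+
qed

lemma biclique_embedding_Int:
  assumes emb: "biclique_embedding X Y pt \<gamma>" and "x \<in> X" "y \<in> Y" "x' \<in> X" "y' \<in> Y"
  shows "x \<noteq> x' \<Longrightarrow> y \<noteq> y' \<Longrightarrow> path_image (\<gamma> x y) \<inter> path_image (\<gamma> x' y') = {}"
    and "y \<noteq> y' \<Longrightarrow> path_image (\<gamma> x y) \<inter> path_image (\<gamma> x y') \<subseteq> {pt x}"
    and "x \<noteq> x' \<Longrightarrow> path_image (\<gamma> x y) \<inter> path_image (\<gamma> x' y) \<subseteq> {pt y}"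
proof -
  have "pt u \<noteq> pt v" if "u \<in> X" "v \<in> Y" for u v
    using biclique_embedding_arc[OF emb that] arc_distinct_ends by metis
  then have neq: "x \<noteq> y" "x \<noteq> y'" "x' \<noteq> y" "x' \<noteq> y'"
    using assms by auto
  have Int: "path_image (\<gamma> u v) \<inter> path_image (\<gamma> u' v') \<subseteq> pt ` ({u, v} \<inter> {u', v'})"
    if "u \<in> X" "v \<in> Y" "u' \<in> X" "v' \<in> Y" "(u, v) \<noteq> (u', v')" for u v u' v'
    using emb that unfolding biclique_embedding_def by blast
  show "path_image (\<gamma> x y) \<inter> path_image (\<gamma> x' y') = {}" if "x \<noteq> x'" "y \<noteq> y'"
    using Int[of x y x' y'] that neq assms by auto
  show "path_image (\<gamma> x y) \<inter> path_image (\<gamma> x y') \<subseteq> {pt x}" if "y \<noteq> y'"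
    using Int[of x y x y'] that neq assms by auto
  show "path_image (\<gamma> x y) \<inter> path_image (\<gamma> x' y) \<subseteq> {pt y}" if "x \<noteq> x'"
    using Int[of x y x' y] that neq assms by auto
qed

lemma biclique_embedding_bigon:
  assumes emb: "biclique_embedding X Y pt \<gamma>"
    and x: "x \<in> X" "x' \<in> X" "x \<noteq> x'" and y: "y \<in> Y" "y' \<in> Y" "y \<noteq> y'"
  shows "bigon (pt x) (pt x') (\<gamma> x y +++ reversepath (\<gamma> x' y)) (\<gamma> x y' +++ reversepath (\<gamma> x' y'))"
    (is "bigon _ _ (?c y) (?c y')")
proof -
  note arcs = biclique_embedding_arc[OF emb] and Int = biclique_embedding_Int[OF emb]
  have "arc (?c v)" if "v \<in> Y" for v
    using arcs x that Int(3)[of x v x'] by (intro arc_join) (auto simp: arc_reversepath)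
  moreover have image: "path_image (?c v) = bigon_image (\<gamma> x v) (\<gamma> x' v)" if "v \<in> Y" for v
    using arcs x that by (simp add: path_image_join)
  moreover have "path_image (?c y) \<inter> path_image (?c y') = {pt x, pt x'}"
    unfolding image[OF y(1)] image[OF y(2)]
    using Int(2)[of x y _ y'] Int(2)[of x' y _ y'] Int(1)[of x y x' y'] Int(1)[of x' y x y']
      arcs(4) x y by blast
  ultimately show ?thesis
    using arcs x y by (simp add: bigon_def)
qed

lemma no_K33_embedding_complex:
  fixes pt :: "'i \<Rightarrow> complex"
  assumes "card X = 3" "card Y = 3"
  shows "\<not> biclique_embedding X Y pt \<gamma>"
proof
  assume emb: "biclique_embedding X Y pt \<gamma>"
  note arcs = biclique_embedding_arc[OF emb] and Int = biclique_embedding_Int[OF emb]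
  obtain x1 x2 x3 where X: "x1 \<in> X" "x2 \<in> X" "x3 \<in> X" "distinct [x1, x2, x3]"
    using \<open>card X = 3\<close> by (auto simp: card_3_iff)
  obtain y1 y2 y3 where Y: "y1 \<in> Y" "y2 \<in> Y" "y3 \<in> Y" "distinct [y1, y2, y3]"
    using \<open>card Y = 3\<close> by (auto simp: card_3_iff)
  define c where "c y = \<gamma> x1 y +++ reversepath (\<gamma> x2 y)" for y
  have image: "path_image (c y) = bigon_image (\<gamma> x1 y) (\<gamma> x2 y)" if "y \<in> Y" for y
    using arcs X that by (simp add: c_def path_image_join)
  have theta: "theta (pt x1) (pt x2) (c y1) (c y2) (c y3)"
    using biclique_embedding_bigon[OF emb, of x1 x2] X Y by (simp add: theta_def c_def)
  have q: "pt y \<in> path_image (c y)" if "y \<in> Y" for y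
    using arcs(5) X that by (simp add: image)
  have leg: "connected_component (- bigon_image (c y') (c y'')) (pt x3) (pt y)"
    if "y \<in> Y" "y' \<in> Y" "y'' \<in> Y" "y \<noteq> y'" "y \<noteq> y''" for y y' y''
  proof (rule connected_componentI)
    have "path_image (\<gamma> x3 y) \<inter> path_image (c z) = {}" if "z \<in> Y" "y \<noteq> z" for z
      using Int(1)[of x3 y x1 z] Int(1)[of x3 y x2 z] X \<open>y \<in> Y\<close> that by (auto simp: image)
    then show "path_image (\<gamma> x3 y) \<subseteq> - bigon_image (c y') (c y'')"
      using that by blast
  qed (use arcs connected_arc_image X(3) \<open>y \<in> Y\<close> in blast)+
  show False
    by (rule theta_no_tripod[OF theta q leg q leg q leg]) (use Y in auto)
qed

theorem no_K33_embedding: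
  fixes pt :: "'i \<Rightarrow> 'a::euclidean_space"
  assumes "DIM('a) = 2" "card X = 3" "card Y = 3"
  shows "\<not> biclique_embedding X Y pt \<gamma>"
proof -
  have "DIM('a) = DIM(complex)"
    using assms by simp
  then obtain h :: "'a \<Rightarrow> complex" and g :: "complex \<Rightarrow> 'a"
    where "linear h" and g: "\<And>z. g (h z) = z"
    by (rule isomorphisms_UNIV_UNIV) (rule that)
  moreover have "inj h"
    using g by (rule inj_on_inverseI)
  ultimately show ?thesis
    using biclique_embedding_linear_image no_K33_embedding_complex assms(2,3) by blast
qed

section \<open>Meets of curves\<close>

definition counterpart :: "(real \<Rightarrow> 'b) \<Rightarrow> (real \<Rightarrow> 'b) \<Rightarrow> real \<Rightarrow> real" where
  "counterpart \<gamma>1 \<gamma>2 x = inv_into {0..1} \<gamma>2 (\<gamma>1 x)"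

text \<open>If \<open>\<gamma>2\<close> is injective, then a common part is determined by its first interval, so that common
  parts can be compared by inclusion of these intervals.\<close>

definition common_domain :: "(real \<Rightarrow> 'b) \<Rightarrow> (real \<Rightarrow> 'b) \<Rightarrow> real set \<Rightarrow> bool" where
  "common_domain \<gamma>1 \<gamma>2 J \<longleftrightarrow> J \<noteq> {} \<and> is_interval J \<and> J \<subseteq> {0..1} \<and>
     inj_on \<gamma>1 J \<and> \<gamma>1 ` J \<subseteq> \<gamma>2 ` {0..1} \<and> is_interval (counterpart \<gamma>1 \<gamma>2 ` J)"

lemma
  assumes "\<gamma>1 x \<in> \<gamma>2 ` {0..1}"
  shows counterpart_in_unit_interval: "counterpart \<gamma>1 \<gamma>2 x \<in> {0..1}"
    and apply_counterpart: "\<gamma>2 (counterpart \<gamma>1 \<gamma>2 x) = \<gamma>1 x"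
  unfolding counterpart_def using assms by (rule inv_into_into, rule f_inv_into_f)

lemma common_part_iff_common_domain:
  assumes inj: "inj_on \<gamma>2 {0..1}"
  shows "common_part \<gamma>1 \<gamma>2 I1 I2 \<iota> \<longleftrightarrow>
    common_domain \<gamma>1 \<gamma>2 I1 \<and> I2 = counterpart \<gamma>1 \<gamma>2 ` I1 \<and> (\<forall>x\<in>I1. \<iota> x = counterpart \<gamma>1 \<gamma>2 x)"
    (is "?common_part \<longleftrightarrow> ?domain")
proof
  assume common: ?common_part
  then have \<iota>: "inj_on \<iota> I1" "\<iota> ` I1 = I2" "I2 \<subseteq> {0..1}" "\<And>x. x \<in> I1 \<Longrightarrow> \<gamma>1 x = \<gamma>2 (\<iota> x)"
    by (auto simp: common_part_def bij_betw_def)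
  then have "inj_on (\<gamma>2 \<circ> \<iota>) I1"
    using inj by (auto intro: comp_inj_on inj_on_subset)
  then have "inj_on \<gamma>1 I1"
    using \<iota>(4) by (simp add: inj_on_def)
  moreover have \<iota>_eq: "\<iota> x = counterpart \<gamma>1 \<gamma>2 x" if "x \<in> I1" for x
    using inv_into_f_f[OF inj, of "\<iota> x"] \<iota> that by (auto simp: counterpart_def)
  moreover have "I2 = counterpart \<gamma>1 \<gamma>2 ` I1"
    using \<iota>(2) \<iota>_eq by (metis image_cong)
  moreover have "\<gamma>1 ` I1 \<subseteq> \<gamma>2 ` {0..1}"
    using \<iota> by blast
  ultimately show ?domain
    using common by (auto simp: common_part_def common_domain_def)
next
  assume domain: ?domain
  then have on_\<gamma>2: "\<gamma>1 x \<in> \<gamma>2 ` {0..1}" if "x \<in> I1" for x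
    using that by (auto simp: common_domain_def)
  have "inj_on \<iota> I1"
    using domain apply_counterpart[of \<gamma>1 _ \<gamma>2] on_\<gamma>2 by (metis common_domain_def inj_on_def)
  moreover have "\<iota> ` I1 = I2"
    using domain by (metis image_cong)
  ultimately show ?common_part
    using domain counterpart_in_unit_interval[of \<gamma>1 _ \<gamma>2] apply_counterpart[of \<gamma>1 _ \<gamma>2] on_\<gamma>2
    by (auto simp: common_part_def common_domain_def bij_betw_def)
qed

lemma common_domain_Union_chain:
  assumes chain: "subset.chain (Collect (common_domain \<gamma>1 \<gamma>2)) C" and s: "C \<noteq> {}" "s \<in> \<Inter>C"
  shows "common_domain \<gamma>1 \<gamma>2 (\<Union>C)"
proof -
  have C: "common_domain \<gamma>1 \<gamma>2 X" if "X \<in> C" for X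
    using chain that by (auto simp: subset_chain_def)
  have "inj_on \<gamma>1 (\<Union>X\<in>C. X)"
    using chain C by (intro inj_on_UNION_chain) (auto simp: subset_chain_def common_domain_def)
  moreover have interval: "is_interval (\<Union>X\<in>C. f ` X)"
    if "\<And>X. X \<in> C \<Longrightarrow> is_interval (f ` X)" for f :: "real \<Rightarrow> real"
  proof -
    have "(\<Inter>X\<in>C. f ` X) \<noteq> {}"
      using s(2) by blast
    from connected_Union[OF _ this] show ?thesis
      using that unfolding is_interval_connected_1 by blast
  qed
  moreover have "is_interval (\<Union>C)" "is_interval (\<Union>X\<in>C. counterpart \<gamma>1 \<gamma>2 ` X)"
    using interval[of "\<lambda>x. x"] interval[of "counterpart \<gamma>1 \<gamma>2"] C by (auto simp: common_domain_def)
  moreover have "\<Union>C \<noteq> {}" "\<Union>C \<subseteq> {0..1}" "\<gamma>1 ` \<Union>C \<subseteq> \<gamma>2 ` {0..1}"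
    using s C unfolding common_domain_def by blast+
  ultimately show ?thesis
    by (simp add: common_domain_def image_Union)
qed

lemma common_domain_extends_to_maximal:
  assumes "common_domain \<gamma>1 \<gamma>2 J"
  obtains M where "common_domain \<gamma>1 \<gamma>2 M" "J \<subseteq> M"
    "\<forall>X. common_domain \<gamma>1 \<gamma>2 X \<longrightarrow> M \<subseteq> X \<longrightarrow> X = M"
proof -
  define \<A> where "\<A> = {M. common_domain \<gamma>1 \<gamma>2 M \<and> J \<subseteq> M}"
  obtain s where "s \<in> J"
    using assms by (auto simp: common_domain_def)
  have "\<exists>M\<in>\<A>. \<forall>X\<in>\<A>. M \<subseteq> X \<longrightarrow> X = M"
  proof (rule subset_Zorn_nonempty)
    show "\<A> \<noteq> {}"
      using assms by (auto simp: \<A>_def)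
    fix C assume C: "C \<noteq> {}" "subset.chain \<A> C"
    then have "subset.chain (Collect (common_domain \<gamma>1 \<gamma>2)) C" "\<forall>X\<in>C. J \<subseteq> X"
      by (auto simp: subset_chain_def \<A>_def)
    then show "\<Union>C \<in> \<A>"
      using common_domain_Union_chain[of \<gamma>1 \<gamma>2 C s] C(1) \<open>s \<in> J\<close> by (auto simp: \<A>_def)
  qed
  then show ?thesis
    using that by (auto simp: \<A>_def)
qed

lemma meet_atE:
  assumes inj: "inj_on \<gamma>2 {0..1}" and s: "s \<in> {0..1}" "\<gamma>1 s \<in> \<gamma>2 ` {0..1}"
  obtains I1 I2 \<iota> where "(I1, I2, \<iota>) \<in> meets \<gamma>1 \<gamma>2" "s \<in> I1"
proof -
  have singleton: "common_domain \<gamma>1 \<gamma>2 {s}"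
    using s by (auto simp: common_domain_def is_interval_1)
  obtain M where M: "common_domain \<gamma>1 \<gamma>2 M" "{s} \<subseteq> M"
    "\<forall>X. common_domain \<gamma>1 \<gamma>2 X \<longrightarrow> M \<subseteq> X \<longrightarrow> X = M"
    using common_domain_extends_to_maximal[OF singleton] .
  have "(M, counterpart \<gamma>1 \<gamma>2 ` M, restrict (counterpart \<gamma>1 \<gamma>2) M) \<in> meets \<gamma>1 \<gamma>2"
    using M(1,3) by (auto simp: meets_def common_part_iff_common_domain[OF inj])
  then show ?thesis
    using that M(2) by blast
qed

lemma meet_times_2I:
  assumes inj: "inj_on \<gamma>2 {0..1}"
    and s: "s \<in> {0..1}" "\<gamma>1 s \<in> \<gamma>2 ` {0..1}" and t: "t \<in> {0..1}" "\<gamma>1 t \<in> \<gamma>2 ` {0..1}"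
    and separated: "\<not> (inj_on \<gamma>1 {s..t} \<and> \<gamma>1 ` {s..t} \<subseteq> \<gamma>2 ` {0..1})"
  shows "meet_times \<gamma>1 \<gamma>2 2"
proof -
  obtain I1 I2 \<iota> where I1: "(I1, I2, \<iota>) \<in> meets \<gamma>1 \<gamma>2" "s \<in> I1"
    using meet_atE[of \<gamma>2 s \<gamma>1, OF inj s] .
  obtain J1 J2 \<kappa> where J1: "(J1, J2, \<kappa>) \<in> meets \<gamma>1 \<gamma>2" "t \<in> J1"
    using meet_atE[of \<gamma>2 t \<gamma>1, OF inj t] .
  have "t \<notin> I1"
  proof
    assume "t \<in> I1"
    have domain: "is_interval I1" "inj_on \<gamma>1 I1" "\<gamma>1 ` I1 \<subseteq> \<gamma>2 ` {0..1}"
      using I1(1) common_part_iff_common_domain[OF inj] by (auto simp: meets_def common_domain_def)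
    have sub: "{s..t} \<subseteq> I1"
      using mem_is_interval_1_I[OF domain(1) \<open>s \<in> I1\<close> \<open>t \<in> I1\<close>] by auto
    then show False
      using separated inj_on_subset[OF domain(2) sub] image_mono[OF sub, of \<gamma>1] domain(3) by simp
  qed
  then have "I1 \<noteq> J1"
    using J1(2) by blast
  then show ?thesis
    using I1(1) J1(1) unfolding meet_times_def
    by (intro exI[of _ "{(I1, I2, \<iota>), (J1, J2, \<kappa>)}"]) simp
qed

lemma path_image_join_first_half:
  assumes "y \<in> path_image g"
  obtains s where "0 \<le> s" "s \<le> 1/2" "(g +++ h) s = y"
proof -
  obtain r where "0 \<le> r" "r \<le> 1" "g r = y"
    using assms by (auto simp: path_image_def)
  then show ?thesis
    using that[of "r/2"] by (auto simp: joinpaths_def)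
qed

lemma join_meet_times_2_second_path:
  assumes "arc h" "pathfinish g = pathstart h"
    and y: "y \<in> path_image g" "y \<in> path_image h" "y \<noteq> pathstart h"
  shows "meet_times (g +++ h) h 2"
proof -
  obtain s where s: "0 \<le> s" "s \<le> 1/2" "(g +++ h) s = y"
    using path_image_join_first_half[OF y(1)] .
  obtain r where r: "0 \<le> r" "r \<le> 1" "h r = y"
    using y by (auto simp: path_image_def)
  define t where "t = (1 + r) / 2"
  have "r \<noteq> 0"
    using r(3) y(3) by (auto simp: pathstart_def)
  then have t: "1/2 < t" "t \<le> 1" "(g +++ h) t = y"
    using r by (simp_all add: t_def joinpaths_def add_divide_distrib)
  have "\<not> inj_on (g +++ h) {s..t}"
    using s t by (auto dest!: inj_onD[where x = s and y = t])
  then show ?thesis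
    using meet_times_2I[of h s "g +++ h" t] s t y(2) \<open>arc h\<close> by (auto simp: arc_def path_image_def)
qed

lemma join_meet_times_2_finish:
  assumes "arc k" and y: "y \<in> path_image g" "y \<in> path_image k"
    and "pathfinish g \<notin> path_image k" "pathfinish h \<in> path_image k"
  shows "meet_times (g +++ h) k 2"
proof -
  obtain s where s: "0 \<le> s" "s \<le> 1/2" "(g +++ h) s = y"
    using path_image_join_first_half[OF y(1)] .
  have "(g +++ h) 1 = pathfinish h" "(g +++ h) (1/2) = pathfinish g"
    by (simp_all add: joinpaths_def pathfinish_def)
  moreover have "1/2 \<in> {s..1}"
    using s by simp
  ultimately have "\<not> (g +++ h) ` {s..1} \<subseteq> k ` {0..1}"
    using assms(4) unfolding path_image_def by (metis image_subset_iff)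
  then show ?thesis
    using meet_times_2I[of k s "g +++ h" 1] s \<open>(g +++ h) 1 = pathfinish h\<close> y(2) assms(1,5)
    by (simp add: arc_def path_image_def)
qed

section \<open>Geodetic graphs of diameter two\<close>

lemma graph_path_le_3_cases:
  assumes "graph_path V E u v p" "length p \<le> 3"
  obtains "u = v" "p = [u]"
  | "u \<noteq> v" "{u, v} \<in> E" "p = [u, v]"
  | w where "u \<noteq> v" "{u, w} \<in> E" "{w, v} \<in> E" "p = [u, w, v]"
proof -
  consider x where "p = [x]" | x y where "p = [x, y]" | x w y where "p = [x, w, y]"
    using assms by (cases p; cases "tl p"; cases "tl (tl p)") (auto simp: graph_path_def)
  then show ?thesis
    using assms(1) that by cases (auto simp: graph_path_def)
qed

lemma shortest_path_iff_eq:
  assumes "graph_path V E u v p"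
    and "\<And>q. graph_path V E u v q \<Longrightarrow> length q \<le> length p \<Longrightarrow> q = p"
  shows "shortest_path V E u v q \<longleftrightarrow> q = p"
  using assms unfolding shortest_path_def by (metis nle_le)

lemma graph_dist_eq_length_shortest_path:
  assumes "shortest_path V E u v p"
  shows "graph_dist V E u v = length p - 1"
  unfolding graph_dist_def
proof (rule Least_equality)
  show "\<exists>q. graph_path V E u v q \<and> length q = Suc (length p - 1)"
    using assms by (intro exI[of _ p]) (auto simp: shortest_path_def graph_path_def)
  show "length p - 1 \<le> n" if "\<exists>q. graph_path V E u v q \<and> length q = Suc n" for n
    using assms that by (fastforce simp: shortest_path_def)
qed

lemma simple_graph_edgeD: "simple_graph V E \<Longrightarrow> {u, v} \<in> E \<Longrightarrow> u \<in> V \<and> v \<in> V \<and> u \<noteq> v"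
  by (auto simp: simple_graph_def)

lemma simple_graph_edgeE:
  assumes "simple_graph V E" "e \<in> E"
  obtains u v where "e = {u, v}" "u \<noteq> v"
  using assms by (auto simp: simple_graph_def card_2_iff)

lemma shortest_path_self_iff: "u \<in> V \<Longrightarrow> shortest_path V E u u p \<longleftrightarrow> p = [u]"
  by (rule shortest_path_iff_eq) (auto simp: graph_path_def length_Suc_conv le_Suc_eq)

lemma shortest_path_edge_iff:
  assumes "simple_graph V E" "{u, v} \<in> E"
  shows "shortest_path V E u v p \<longleftrightarrow> p = [u, v]"
proof (rule shortest_path_iff_eq)
  show "graph_path V E u v [u, v]"
    using simple_graph_edgeD[OF assms] assms(2) by (simp add: graph_path_def)
  show "q = [u, v]" if "graph_path V E u v q" "length q \<le> length [u, v]" for q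
    using that simple_graph_edgeD[OF assms] by (auto elim: graph_path_le_3_cases)
qed

locale unique_common_neighbour_graph =
  fixes V :: "'a set" and E :: "'a set set"
  assumes simple: "simple_graph V E"
    and unique_common_neighbour: "u \<in> V \<Longrightarrow> v \<in> V \<Longrightarrow> u \<noteq> v \<Longrightarrow> {u, v} \<notin> E \<Longrightarrow>
      \<exists>!w. {u, w} \<in> E \<and> {w, v} \<in> E"
begin

lemmas edgeD = simple_graph_edgeD[OF simple]

lemma shortest_path_two_edges_iff:
  assumes edges: "{u, w} \<in> E" "{w, v} \<in> E" and "u \<noteq> v" "{u, v} \<notin> E"
  shows "shortest_path V E u v p \<longleftrightarrow> p = [u, w, v]"
proof (rule shortest_path_iff_eq)
  show "graph_path V E u v [u, w, v]"
    using edges edgeD[OF edges(1)] edgeD[OF edges(2)] \<open>u \<noteq> v\<close> by (simp add: graph_path_def)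
  fix q assume "graph_path V E u v q" "length q \<le> length [u, w, v]"
  then obtain w' where "{u, w'} \<in> E" "{w', v} \<in> E" "q = [u, w', v]"
    using assms(3,4) by (auto elim: graph_path_le_3_cases)
  then show "q = [u, w, v]"
    using unique_common_neighbour[of u v] assms edgeD by blast
qed

lemma unique_shortest_pathE:
  assumes "u \<in> V" "v \<in> V"
  obtains p where "\<And>q. shortest_path V E u v q \<longleftrightarrow> q = p" "length p \<le> 3"
proof -
  consider (same) "u = v" | (edge) "{u, v} \<in> E"
    | (common_neighbour) w where "u \<noteq> v" "{u, v} \<notin> E" "{u, w} \<in> E" "{w, v} \<in> E"
    using unique_common_neighbour assms by metis
  then show ?thesis
  proof cases
    case same
    then show ?thesis
      using that[of "[u]"] shortest_path_self_iff[of u V E] assms by simp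
  next
    case edge
    then show ?thesis
      using that[of "[u, v]"] shortest_path_edge_iff[OF simple] by simp
  next
    case (common_neighbour w)
    then show ?thesis
      using that[of "[u, w, v]"] shortest_path_two_edges_iff by simp
  qed
qed

theorem geodetic: "geodetic V E"
  unfolding geodetic_def using unique_shortest_pathE by metis

theorem graph_diameter_eq_2:
  assumes "u \<in> V" "v \<in> V" "u \<noteq> v" "{u, v} \<notin> E"
  shows "graph_diameter V E = 2"
proof -
  let ?D = "{graph_dist V E x y | x y. x \<in> V \<and> y \<in> V}"
  have "graph_dist V E x y \<le> 2" if xy: "x \<in> V" "y \<in> V" for x y
  proof -
    obtain p where "shortest_path V E x y p" "length p \<le> 3"
      using unique_shortest_pathE[OF xy] by metis
    then show ?thesis
      by (simp add: graph_dist_eq_length_shortest_path)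
  qed
  then have "?D \<subseteq> {..2}"
    by auto
  moreover have "2 \<in> ?D"
  proof -
    obtain w where "{u, w} \<in> E" "{w, v} \<in> E"
      using unique_common_neighbour assms by blast
    then have "shortest_path V E u v [u, w, v]"
      using shortest_path_two_edges_iff assms by blast
    then have "graph_dist V E u v = 2"
      by (simp add: graph_dist_eq_length_shortest_path)
    then show ?thesis
      using assms by force
  qed
  ultimately show ?thesis
    unfolding graph_diameter_def by (intro Max_eqI) (auto intro: finite_subset)
qed

end

locale triangle_free_unique_common_neighbour_graph = unique_common_neighbour_graph +
  assumes triangle_free: "{u, v} \<in> E \<Longrightarrow> {v, w} \<in> E \<Longrightarrow> {u, w} \<notin> E"
begin

lemma two_edge_path_shortest:
  assumes "{u, w} \<in> E" "{w, v} \<in> E" "u \<noteq> v"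
  shows "shortest_path V E u v [u, w, v]"
  using assms triangle_free shortest_path_two_edges_iff by blast

end

section \<open>Plane drawings\<close>

fun path_edges :: "'a list \<Rightarrow> 'a set set" where
  "path_edges (u # v # p) = insert {u, v} (path_edges (v # p))"
| "path_edges _ = {}"

lemma Union_path_edges_subset: "\<Union>(path_edges p) \<subseteq> set p"
  by (induction p rule: path_edges.induct) auto

lemma path_edges_subset: "successively (\<lambda>x y. {x, y} \<in> E) p \<Longrightarrow> path_edges p \<subseteq> E"
  by (induction p rule: path_edges.induct) auto

definition biclique_subdivision ::
    "'a set \<Rightarrow> 'a set set \<Rightarrow> 'a set \<Rightarrow> 'a set \<Rightarrow> ('a \<Rightarrow> 'a \<Rightarrow> 'a list) \<Rightarrow> bool" where
  "biclique_subdivision V E X Y P \<longleftrightarrow> X \<inter> Y = {} \<and>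
     (\<forall>x\<in>X. \<forall>y\<in>Y. graph_path V E x y (P x y)) \<and>
     (\<forall>x\<in>X. \<forall>y\<in>Y. \<forall>x'\<in>X. \<forall>y'\<in>Y. (x, y) \<noteq> (x', y') \<longrightarrow>
        set (P x y) \<inter> set (P x' y') \<subseteq> {x, y} \<inter> {x', y'})"

locale graph_drawing =
  fixes V :: "'a set" and E :: "'a set set"
    and pt :: "'a \<Rightarrow> real^2" and crv :: "'a set \<Rightarrow> real \<Rightarrow> real^2"
  assumes simple: "simple_graph V E" and drawn: "drawing V E pt crv"
begin

abbreviation img :: "'a set \<Rightarrow> (real^2) set" where
  "img e \<equiv> path_image (crv e)"

lemma pt_in_img_iff: "w \<in> V \<Longrightarrow> e \<in> E \<Longrightarrow> pt w \<in> img e \<longleftrightarrow> w \<in> e"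
  using drawn pathstart_in_path_image pathfinish_in_path_image unfolding drawing_def
  by (metis DiffI imageI insertE singletonD)

lemma edge_curve_simps:
  assumes "{u, v} \<in> E"
  shows "arc (edge_curve pt crv u v)" "pathstart (edge_curve pt crv u v) = pt u"
    "pathfinish (edge_curve pt crv u v) = pt v" "path_image (edge_curve pt crv u v) = img {u, v}"
proof -
  have "arc (crv {u, v})" "{pathstart (crv {u, v}), pathfinish (crv {u, v})} = {pt u, pt v}"
    using drawn assms by (auto simp: drawing_def)
  moreover have "pt u \<noteq> pt v"
    using drawn simple_graph_edgeD[OF simple assms] by (auto simp: drawing_def inj_on_eq_iff)
  ultimately show "arc (edge_curve pt crv u v)" "pathstart (edge_curve pt crv u v) = pt u"
    "pathfinish (edge_curve pt crv u v) = pt v" "path_image (edge_curve pt crv u v) = img {u, v}"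
    by (auto simp: edge_curve_def arc_reversepath doubleton_eq_iff)
qed

end

locale plane_drawing = graph_drawing +
  assumes img_Int: "e \<in> E \<Longrightarrow> f \<in> E \<Longrightarrow> e \<noteq> f \<Longrightarrow> img e \<inter> img f \<subseteq> pt ` (e \<inter> f)"
begin

lemma img_Union_Int:
  assumes "F \<subseteq> E" "G \<subseteq> E" "F \<inter> G = {}"
  shows "\<Union>(img ` F) \<inter> \<Union>(img ` G) \<subseteq> pt ` (\<Union>F \<inter> \<Union>G)"
proof
  fix y assume "y \<in> \<Union>(img ` F) \<inter> \<Union>(img ` G)"
  then obtain e f where ef: "e \<in> F" "f \<in> G" "y \<in> img e \<inter> img f"
    by blast
  then have "y \<in> pt ` (e \<inter> f)"
    using img_Int[of e f] assms by blast
  then show "y \<in> pt ` (\<Union>F \<inter> \<Union>G)"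
    using ef by blast
qed

lemma path_curve_walk:
  assumes "successively (\<lambda>x y. {x, y} \<in> E) p" "distinct p" "length p > 1"
  shows "arc (path_curve pt crv p) \<and> pathstart (path_curve pt crv p) = pt (hd p) \<and>
    pathfinish (path_curve pt crv p) = pt (last p) \<and>
    path_image (path_curve pt crv p) = \<Union>(img ` path_edges p)"
  using assms
proof (induction p rule: path_edges.induct)
  case (1 u v p)
  let ?q = "v # p"
  have uv: "{u, v} \<in> E"
    using 1 by simp
  show ?case
  proof (cases p)
    case Nil
    then show ?thesis
      using uv by (simp add: edge_curve_simps)
  next
    case (Cons w ws)
    then have q: "arc (path_curve pt crv ?q)" "pathstart (path_curve pt crv ?q) = pt v"
      "pathfinish (path_curve pt crv ?q) = pt (last p)"
      "path_image (path_curve pt crv ?q) = \<Union>(img ` path_edges ?q)" and "path_edges ?q \<subseteq> E"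
      using 1 path_edges_subset[of E ?q] by auto
    have "u \<notin> \<Union>(path_edges ?q)"
      using Union_path_edges_subset[of ?q] 1 by auto
    then have "\<Union>(img ` {{u, v}}) \<inter> \<Union>(img ` path_edges ?q) \<subseteq> {pt v}"
      using img_Union_Int[of "{{u, v}}" "path_edges ?q"] uv \<open>path_edges ?q \<subseteq> E\<close> by blast
    then have "arc (edge_curve pt crv u v +++ path_curve pt crv ?q)"
      using q uv by (intro arc_join) (auto simp: edge_curve_simps)
    then show ?thesis
      using q uv Cons by (simp add: edge_curve_simps path_image_join)
  qed
qed simp_all

lemma path_curve_simps:
  assumes "graph_path V E u v p" "u \<noteq> v"
  shows "arc (path_curve pt crv p)" "pathstart (path_curve pt crv p) = pt u"
    "pathfinish (path_curve pt crv p) = pt v"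
    "path_image (path_curve pt crv p) = \<Union>(img ` path_edges p)"
proof -
  have "length p > 1"
    using assms by (cases p; cases "tl p") (auto simp: graph_path_def)
  from path_curve_walk[OF _ _ this] show "arc (path_curve pt crv p)"
    "pathstart (path_curve pt crv p) = pt u" "pathfinish (path_curve pt crv p) = pt v"
    "path_image (path_curve pt crv p) = \<Union>(img ` path_edges p)"
    using assms(1) by (auto simp: graph_path_def)
qed

lemma path_curve_Int:
  assumes p: "graph_path V E u v p" "u \<noteq> v" and q: "graph_path V E u' v' q" "u' \<noteq> v'"
    and common: "set p \<inter> set q \<subseteq> {x}"
  shows "path_image (path_curve pt crv p) \<inter> path_image (path_curve pt crv q) \<subseteq> pt ` (set p \<inter> set q)"
proof -
  have sub: "path_edges p \<subseteq> E" "path_edges q \<subseteq> E"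
    using p(1) q(1) path_edges_subset by (auto simp: graph_path_def)
  have vertices: "\<Union>(path_edges p) \<inter> \<Union>(path_edges q) \<subseteq> set p \<inter> set q"
    using Union_path_edges_subset[of p] Union_path_edges_subset[of q] by blast
  have disjoint: "path_edges p \<inter> path_edges q = {}"
  proof (rule ccontr)
    assume "path_edges p \<inter> path_edges q \<noteq> {}"
    then obtain e where e: "e \<in> path_edges p" "e \<in> path_edges q"
      by blast
    then obtain a b where "e = {a, b}" "a \<noteq> b"
      using simple_graph_edgeE[OF simple] sub by blast
    then show False
      using e vertices common by blast
  qed
  have "path_image (path_curve pt crv p) \<inter> path_image (path_curve pt crv q) \<subseteq>
      pt ` (\<Union>(path_edges p) \<inter> \<Union>(path_edges q))"
    unfolding path_curve_simps(4)[OF p] path_curve_simps(4)[OF q]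
    by (rule img_Union_Int[OF sub disjoint])
  then show ?thesis
    using image_mono[OF vertices] by (rule order_trans)
qed

theorem biclique_embedding_of_subdivision:
  assumes "biclique_subdivision V E X Y P"
  shows "biclique_embedding X Y pt (\<lambda>x y. path_curve pt crv (P x y))"
proof -
  have path: "graph_path V E x y (P x y)" "x \<noteq> y" if "x \<in> X" "y \<in> Y" for x y
    using assms that by (auto simp: biclique_subdivision_def)
  have "path_image (path_curve pt crv (P x y)) \<inter> path_image (path_curve pt crv (P x' y'))
      \<subseteq> pt ` ({x, y} \<inter> {x', y'})"
    if xy: "x \<in> X" "y \<in> Y" and xy': "x' \<in> X" "y' \<in> Y" and "(x, y) \<noteq> (x', y')" for x y x' y'
  proof -
    have common: "set (P x y) \<inter> set (P x' y') \<subseteq> {x, y} \<inter> {x', y'}"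
      using assms that unfolding biclique_subdivision_def by blast
    also have "\<dots> \<subseteq> {if x = x' then x else y}"
      using that path(2) by auto
    finally have "path_image (path_curve pt crv (P x y)) \<inter> path_image (path_curve pt crv (P x' y'))
      \<subseteq> pt ` (set (P x y) \<inter> set (P x' y'))"
      by (rule path_curve_Int[OF path[OF xy] path[OF xy']])
    then show ?thesis
      using image_mono[OF common, of pt] by (rule order_trans)
  qed
  then show ?thesis
    using path_curve_simps(1-3)[OF path] unfolding biclique_embedding_def by blast
qed

corollary no_K33_subdivision:
  assumes "card X = 3" "card Y = 3"
  shows "\<not> biclique_subdivision V E X Y P"
  using biclique_embedding_of_subdivision no_K33_embedding[OF _ assms, of pt] by auto

end

section \<open>Philogeodetic drawings\<close>

definition philogeodetic_drawing ::
    "'a set \<Rightarrow> 'a set set \<Rightarrow> ('a \<Rightarrow> real^2) \<Rightarrow> ('a set \<Rightarrow> real \<Rightarrow> real^2) \<Rightarrow> bool" where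
  "philogeodetic_drawing V E pt crv \<longleftrightarrow> drawing V E pt crv \<and>
     \<not> (\<exists>P1 P2 u1 v1 u2 v2.
           u1 \<noteq> v1 \<and> shortest_path V E u1 v1 P1 \<and>
           u2 \<noteq> v2 \<and> shortest_path V E u2 v2 P2 \<and>
           P1 \<noteq> P2 \<and> P1 \<noteq> rev P2 \<and>
           (\<exists>k>1. meet_times (path_curve pt crv P1) (path_curve pt crv P2) k))"

locale philogeodetic_drawing_of_triangle_free = triangle_free_unique_common_neighbour_graph +
  fixes pt :: "'a \<Rightarrow> real^2" and crv :: "'a set \<Rightarrow> real \<Rightarrow> real^2"
  assumes philogeodetic: "philogeodetic_drawing V E pt crv"
begin

sublocale graph_drawing
  using simple philogeodetic by unfold_locales (simp_all add: philogeodetic_drawing_def)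

lemma not_meet_twice:
  assumes "u1 \<noteq> v1" "shortest_path V E u1 v1 P1" "u2 \<noteq> v2" "shortest_path V E u2 v2 P2"
    "P1 \<noteq> P2" "P1 \<noteq> rev P2"
  shows "\<not> meet_times (path_curve pt crv P1) (path_curve pt crv P2) 2"
proof
  assume "meet_times (path_curve pt crv P1) (path_curve pt crv P2) 2"
  then have "\<exists>k>1. meet_times (path_curve pt crv P1) (path_curve pt crv P2) k"
    by (intro exI[of _ 2]) simp
  with assms philogeodetic show False
    unfolding philogeodetic_drawing_def by blast
qed

lemma adjacent_img_Int:
  assumes edges: "{a, b} \<in> E" "{b, c} \<in> E" and "a \<noteq> c"
  shows "img {a, b} \<inter> img {b, c} \<subseteq> {pt b}"
proof (rule ccontr)
  assume "\<not> ?thesis"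
  then obtain y where "y \<in> img {a, b}" "y \<in> img {b, c}" "y \<noteq> pt b"
    by blast
  then have "meet_times (path_curve pt crv [a, b, c]) (path_curve pt crv [b, c]) 2"
    using edges by (auto simp: edge_curve_simps intro: join_meet_times_2_second_path)
  moreover have "shortest_path V E a c [a, b, c]" "shortest_path V E b c [b, c]"
    using edges \<open>a \<noteq> c\<close> by (simp_all add: two_edge_path_shortest shortest_path_edge_iff[OF simple])
  ultimately show False
    using not_meet_twice[of a c "[a, b, c]" b c "[b, c]"] \<open>a \<noteq> c\<close> edgeD[OF edges(2)] by simp
qed

lemma img_disjoint_shortest_path_curve:
  assumes edges: "{a, b} \<in> E" "{b, x} \<in> E" and "a \<noteq> x"
    and Q: "shortest_path V E x v Q" "x \<noteq> v" "b \<notin> set Q"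
    and curve: "arc (path_curve pt crv Q)" "pathstart (path_curve pt crv Q) = pt x"
      "pt b \<notin> path_image (path_curve pt crv Q)"
  shows "img {a, b} \<inter> path_image (path_curve pt crv Q) = {}"
proof (rule ccontr)
  assume "\<not> ?thesis"
  then obtain y where "y \<in> img {a, b}" "y \<in> path_image (path_curve pt crv Q)"
    by blast
  then have "meet_times (path_curve pt crv [a, b, x]) (path_curve pt crv Q) 2"
    using edges curve pathstart_in_path_image[of "path_curve pt crv Q"]
    by (auto simp: edge_curve_simps intro!: join_meet_times_2_finish[of _ y])
  moreover have "shortest_path V E a x [a, b, x]"
    using edges \<open>a \<noteq> x\<close> by (rule two_edge_path_shortest)
  moreover have "[a, b, x] \<noteq> Q" "[a, b, x] \<noteq> rev Q"
    using \<open>b \<notin> set Q\<close> by (metis insertI1 list.set_intros(2) list.simps(15) set_rev)+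
  ultimately show False
    using not_meet_twice[of a x "[a, b, x]" x v Q] \<open>a \<noteq> x\<close> Q by simp
qed

lemma img_disjoint_if_joined_by_edge:
  assumes edges: "{a, b} \<in> E" "{b, c} \<in> E" "{c, d} \<in> E" and disj: "{a, b} \<inter> {c, d} = {}"
  shows "img {a, b} \<inter> img {c, d} = {}"
proof -
  have "shortest_path V E c d [c, d]"
    using edges(3) by (simp add: shortest_path_edge_iff[OF simple])
  moreover have "pt b \<notin> img {c, d}"
    using pt_in_img_iff[of b] edgeD[OF edges(1)] edges(3) disj by blast
  ultimately show ?thesis
    using img_disjoint_shortest_path_curve[of a b c d "[c, d]"] edges disj edgeD[OF edges(3)]
    by (auto simp: edge_curve_simps)
qed

lemma img_disjoint_if_joined_by_two_edges:
  assumes edges: "{a, b} \<in> E" "{b, x} \<in> E" "{x, c} \<in> E" "{c, d} \<in> E"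
    and disj: "{a, b} \<inter> {c, d} = {}" and x: "x \<notin> {a, b, c, d}"
  shows "img {a, b} \<inter> img {c, d} = {}"
proof -
  have "shortest_path V E x d [x, c, d]"
    using edges x by (intro two_edge_path_shortest) auto
  moreover have "arc (edge_curve pt crv x c +++ edge_curve pt crv c d)"
    using edges x adjacent_img_Int[of x c d] by (intro arc_join) (auto simp: edge_curve_simps)
  moreover have "path_image (edge_curve pt crv x c +++ edge_curve pt crv c d) =
      img {x, c} \<union> img {c, d}"
    using edges by (simp add: path_image_join edge_curve_simps)
  moreover have "pt b \<notin> img {x, c}" "pt b \<notin> img {c, d}"
    using pt_in_img_iff[of b] edgeD[OF edges(1)] edges disj x by blast+
  ultimately show ?thesis
    using img_disjoint_shortest_path_curve[of a b x d "[x, c, d]"] edges disj x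
    by (auto simp: edge_curve_simps)
qed

lemma img_disjoint:
  assumes edges: "{a, b} \<in> E" "{c, d} \<in> E" and disj: "{a, b} \<inter> {c, d} = {}"
  shows "img {a, b} \<inter> img {c, d} = {}"
proof -
  consider (bc) "{b, c} \<in> E" | (bd) "{b, d} \<in> E" | (ac) "{a, c} \<in> E"
    | (nonadjacent) "{b, c} \<notin> E" "{b, d} \<notin> E" "{a, c} \<notin> E"
    by blast
  then show ?thesis
  proof cases
    case bc
    then show ?thesis
      using img_disjoint_if_joined_by_edge[of a b c d] edges disj by simp
  next
    case bd
    then show ?thesis
      using img_disjoint_if_joined_by_edge[of a b d c] edges disj by (simp add: insert_commute)
  next
    case ac
    then show ?thesis
      using img_disjoint_if_joined_by_edge[of b a c d] edges disj by (simp add: insert_commute)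
  next
    case nonadjacent
    obtain x where x: "{b, x} \<in> E" "{x, c} \<in> E"
      using unique_common_neighbour[of b c] edgeD[OF edges(1)] edgeD[OF edges(2)] disj nonadjacent
      by blast
    moreover have "x \<notin> {a, b, c, d}"
      using x nonadjacent edgeD by (auto simp: insert_commute)
    ultimately show ?thesis
      using img_disjoint_if_joined_by_two_edges[of a b x c d] edges disj by simp
  qed
qed

sublocale plane_drawing
proof
  fix e f assume ef: "e \<in> E" "f \<in> E" "e \<noteq> f"
  obtain a b c d where e: "e = {a, b}" and f: "f = {c, d}"
    using simple_graph_edgeE[OF simple] ef by metis
  consider (disjoint) "e \<inter> f = {}" | "b = c" | "b = d" | "a = c" | "a = d"
    using e f by blast
  then show "img e \<inter> img f \<subseteq> pt ` (e \<inter> f)"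
  proof cases
    case disjoint
    then show ?thesis
      using img_disjoint[of a b c d] ef e f by simp
  qed (use adjacent_img_Int[of a b d] adjacent_img_Int[of a b c] adjacent_img_Int[of b a d]
      adjacent_img_Int[of b a c] ef e f in \<open>auto simp: insert_commute\<close>)
qed

end

section \<open>The Petersen graph\<close>

text \<open>The vertices \<open>0, \<dots>, 5\<close> form a hexagon, the vertices \<open>6, 7, 8\<close> are the midpoints of its long
  diagonals, and \<open>9\<close> is adjacent to these midpoints.\<close>

definition petersen_edge_list :: "(nat \<times> nat) list" where
  "petersen_edge_list = [(0, 1), (1, 2), (2, 3), (3, 4), (4, 5), (5, 0),
     (0, 6), (3, 6), (1, 7), (4, 7), (2, 8), (5, 8), (6, 9), (7, 9), (8, 9)]"

definition petersen_edges :: "nat set set" where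
  "petersen_edges = (\<lambda>(u, v). {u, v}) ` set petersen_edge_list"

definition petersen_adj :: "nat \<Rightarrow> nat \<Rightarrow> bool" where
  "petersen_adj u v \<longleftrightarrow> (u, v) \<in> set petersen_edge_list \<or> (v, u) \<in> set petersen_edge_list"

lemma petersen_edges_iff: "{u, v} \<in> petersen_edges \<longleftrightarrow> petersen_adj u v"
  by (auto simp: petersen_edges_def petersen_adj_def doubleton_eq_iff)

lemma petersen_adjD: "petersen_adj u v \<Longrightarrow> u < 10 \<and> v < 10 \<and> u \<noteq> v"
  by (auto simp: petersen_adj_def petersen_edge_list_def)

lemma petersen_triangle_free:
  "\<forall>u\<in>set [0..<10]. \<forall>v\<in>set [0..<10]. petersen_adj u v \<longrightarrow>
     (\<forall>w\<in>set [0..<10]. petersen_adj v w \<longrightarrow> \<not> petersen_adj u w)"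
  by code_simp

lemma petersen_unique_common_neighbour:
  "\<forall>u\<in>set [0..<10]. \<forall>v\<in>set [0..<10]. u \<noteq> v \<longrightarrow> \<not> petersen_adj u v \<longrightarrow>
     (\<exists>w\<in>set [0..<10]. petersen_adj u w \<and> petersen_adj w v \<and>
       (\<forall>w'\<in>set [0..<10]. petersen_adj u w' \<longrightarrow> petersen_adj w' v \<longrightarrow> w' = w))"
  by code_simp

interpretation petersen: triangle_free_unique_common_neighbour_graph "{..<10}" petersen_edges
proof
  show "simple_graph {..<10} petersen_edges"
    by (auto simp: simple_graph_def petersen_edges_def petersen_edge_list_def)
  show "{u, w} \<notin> petersen_edges" if "{u, v} \<in> petersen_edges" "{v, w} \<in> petersen_edges" for u v w
  proof -
    have adj: "petersen_adj u v" "petersen_adj v w"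
      using that by (simp_all add: petersen_edges_iff)
    then have "u \<in> set [0..<10]" "v \<in> set [0..<10]" "w \<in> set [0..<10]"
      by (auto dest: petersen_adjD)
    with adj petersen_triangle_free show ?thesis
      unfolding petersen_edges_iff by blast
  qed
  show "\<exists>!w. {u, w} \<in> petersen_edges \<and> {w, v} \<in> petersen_edges"
    if uv: "u \<in> {..<10}" "v \<in> {..<10}" "u \<noteq> v" "{u, v} \<notin> petersen_edges" for u v
  proof -
    have "u \<in> set [0..<10]" "v \<in> set [0..<10]" "\<not> petersen_adj u v"
      using uv by (auto simp: petersen_edges_iff)
    with petersen_unique_common_neighbour \<open>u \<noteq> v\<close>
    obtain w where "petersen_adj u w" "petersen_adj w v"
      "\<forall>w'\<in>set [0..<10]. petersen_adj u w' \<longrightarrow> petersen_adj w' v \<longrightarrow> w' = w"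
      by blast
    then show ?thesis
      unfolding petersen_edges_iff using petersen_adjD by (intro ex1I[of _ w]) auto
  qed
qed

definition petersen_hexagon_path :: "nat \<Rightarrow> nat \<Rightarrow> nat list" where
  "petersen_hexagon_path x y = (if petersen_adj x y then [x, y] else [x, 6 + x mod 3, y])"

lemma graph_path_petersen_hexagon_path:
  "\<forall>x\<in>{0, 2, 4}. \<forall>y\<in>{1, 3, 5}. graph_path {..<10} petersen_edges x y (petersen_hexagon_path x y)"
  by (simp add: graph_path_def petersen_hexagon_path_def petersen_edges_iff
      petersen_adj_def petersen_edge_list_def)

lemma petersen_hexagon_path_Int:
  "\<forall>x\<in>{0, 2, 4}. \<forall>y\<in>{1, 3, 5}. \<forall>x'\<in>{0, 2, 4}. \<forall>y'\<in>{1, 3, 5}. (x, y) \<noteq> (x', y') \<longrightarrow>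
     set (petersen_hexagon_path x y) \<inter> set (petersen_hexagon_path x' y') \<subseteq> {x, y} \<inter> {x', y'}"
  by code_simp

lemma petersen_K33_subdivision:
  "biclique_subdivision {..<10} petersen_edges {0, 2, 4} {1, 3, 5} petersen_hexagon_path"
  using graph_path_petersen_hexagon_path petersen_hexagon_path_Int
  unfolding biclique_subdivision_def by auto

lemma petersen_not_philogeodetic: "\<not> philogeodetic_drawing {..<10} petersen_edges pt crv"
proof
  assume "philogeodetic_drawing {..<10} petersen_edges pt crv"
  then interpret philogeodetic_drawing_of_triangle_free "{..<10}" petersen_edges pt crv
    by unfold_locales
  show False
    using no_K33_subdivision[of "{0, 2, 4}" "{1, 3, 5}"] petersen_K33_subdivision by simp
qed

theorem theorem3:
  "\<exists>(V :: nat set) E.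
     finite V \<and> simple_graph V E \<and> geodetic V E \<and> graph_diameter V E = 2 \<and>
     (\<forall>pt crv. drawing V E pt crv \<longrightarrow>
        (\<exists>P1 P2 u1 v1 u2 v2.
           u1 \<noteq> v1 \<and> shortest_path V E u1 v1 P1 \<and>
           u2 \<noteq> v2 \<and> shortest_path V E u2 v2 P2 \<and>
           P1 \<noteq> P2 \<and> P1 \<noteq> rev P2 \<and>
           (\<exists>k>1. meet_times (path_curve pt crv P1) (path_curve pt crv P2) k)))"
proof (intro exI[of _ "{..<10}"] exI[of _ petersen_edges] conjI)
  show "graph_diameter {..<10} petersen_edges = 2"
    by (rule petersen.graph_diameter_eq_2[of 0 2])
      (simp_all add: petersen_edges_iff petersen_adj_def petersen_edge_list_def)
  show "\<forall>pt crv. drawing {..<10} petersen_edges pt crv \<longrightarrow>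
        (\<exists>P1 P2 u1 v1 u2 v2.
           u1 \<noteq> v1 \<and> shortest_path {..<10} petersen_edges u1 v1 P1 \<and>
           u2 \<noteq> v2 \<and> shortest_path {..<10} petersen_edges u2 v2 P2 \<and>
           P1 \<noteq> P2 \<and> P1 \<noteq> rev P2 \<and>
           (\<exists>k>1. meet_times (path_curve pt crv P1) (path_curve pt crv P2) k))"
    using petersen_not_philogeodetic unfolding philogeodetic_drawing_def by blast
qed (simp_all add: petersen.simple petersen.geodetic)

end
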